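(* Let $X$ and $Y$ be real Hilbert spaces, $A:X\rightrightarrows X$ and $B:Y\rightrightarrows Y$ maximally monotone operators and $K:X\to Y$ a linear continuous operator with adjoint $K^*:Y\to X$. Assume that the system of inclusions $$Kx\in B^{-1}y \quad\text{and}\quad -K^*y\in Ax \qquad (\ast)$$ has a solution $(\widehat x,\widehat y)\in X\times Y$. Let $\sigma,\tau>0$ satisfy $\sigma\tau\|K\|^2<1$, let $(x^0,y^0)\in X\times Y$ be arbitrary, set $\overline{x}^0:=x^0$, and for every $n\ge 0$ let $$y^{n+1}:=J_{\sigma B^{-1}}(y^n+\sigma K\overline{x}^n),\qquad x^{n+1}:=J_{\tau A}(x^n-\tau K^*y^{n+1}),\qquad \overline{x}^{n+1}:=2x^{n+1}-x^n .$$ Then the following statements are true. (i) For any $n\ge 0$ it holds $$\frac{\|x^n-\widehat{x}\|^2}{2\tau}+(1-\sigma\tau\|K\|^2)\frac{\|y^n-\widehat{y}\|^2}{2\sigma}\leq \frac{\|x^0-\widehat{x}\|^2}{2\tau}+\frac{\|y^0-\widehat{y}\|^2}{2\sigma},$$ and thus the sequence $(x^n,y^n)_{n\ge 0}$ is bounded. (ii) If $X$ and $Y$ are finite-dimensional, then the sequence $(x^n,y^n)_{n\ge 0}$ converges to a solution of the system of inclusions $(\ast)$.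
   Context: For a set-valued operator $A:X\rightrightarrows X$ on a real Hilbert space, $\operatorname{Gr}A=\{(x,u):u\in Ax\}$ and $A^{-1}$ is the inverse operator, i.e. $x\in A^{-1}u$ iff $u\in Ax$. $A$ is monotone if $\langle x-y,u-v\rangle\ge 0$ for all $(x,u),(y,v)\in\operatorname{Gr}A$, and maximally monotone if moreover its graph has no proper monotone extension in $X\times X$. The resolvent of $A$ is $J_A=(\mathrm{Id}+A)^{-1}$; it is single-valued and everywhere defined when $A$ is maximally monotone. *)

theory Defs
  imports "HOL-Analysis.Analysis"
begin

text \<open>
  A real Hilbert space is a type of sort \<open>{real_inner, complete_space}\<close>, and a set-valued
  operator is a function into sets.
\<close>

definition op_graph :: "('a \<Rightarrow> 'b set) \<Rightarrow> ('a \<times> 'b) set" where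
  "op_graph A = {(x, u). u \<in> A x}"

definition op_inverse :: "('a \<Rightarrow> 'b set) \<Rightarrow> 'b \<Rightarrow> 'a set" where
  "op_inverse A u = {x. u \<in> A x}"

definition op_scale :: "real \<Rightarrow> ('a \<Rightarrow> 'b::real_vector set) \<Rightarrow> 'a \<Rightarrow> 'b set" where
  "op_scale c A x = (\<lambda>u. c *\<^sub>R u) ` A x"

definition monotone_op :: "('a::real_inner \<Rightarrow> 'a set) \<Rightarrow> bool" where
  "monotone_op A \<longleftrightarrow>
    (\<forall>(x, u) \<in> op_graph A. \<forall>(y, v) \<in> op_graph A. 0 \<le> inner (x - y) (u - v))"

definition maximally_monotone :: "('a::real_inner \<Rightarrow> 'a set) \<Rightarrow> bool" where
  "maximally_monotone A \<longleftrightarrow>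
    monotone_op A \<and> \<not> (\<exists>A'. monotone_op A' \<and> op_graph A \<subset> op_graph A')"

text \<open>
  The resolvent \<open>(Id + A)\<inverse>\<close> is kept set-valued; for a maximally monotone \<open>A\<close>
  all of its values are singletons.
\<close>

definition resolvent :: "('a::real_vector \<Rightarrow> 'a set) \<Rightarrow> 'a \<Rightarrow> 'a set" where
  "resolvent A = op_inverse (\<lambda>x. (\<lambda>u. x + u) ` A x)"

text \<open>
  \<^const>\<open>adjoint\<close> is a choice operator: it is the adjoint in the usual sense because bounded
  operators between Hilbert spaces possess a (unique) one.
\<close>

definition inclusion_solution ::
  "('a::real_inner \<Rightarrow> 'a set) \<Rightarrow> ('b::real_inner \<Rightarrow> 'b set) \<Rightarrow> ('a \<Rightarrow> 'b) \<Rightarrow> 'a \<Rightarrow> 'b \<Rightarrow> bool" where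
  "inclusion_solution A B K x y \<longleftrightarrow> K x \<in> op_inverse B y \<and> - adjoint K y \<in> A x"

definition finite_dimensional_space :: "'a::real_vector itself \<Rightarrow> bool" where
  "finite_dimensional_space _ \<longleftrightarrow> (\<exists>S :: 'a set. finite S \<and> span S = UNIV)"

end

theory Submission
  imports Defs
begin

text \<open>
  Let \<open>d\<^sub>n = x\<^sub>n - x\<^sub>n\<^sub>-\<^sub>1\<close> (with \<open>d\<^sub>0 = 0\<close>), so that the extrapolated point is \<open>x\<^sub>n + d\<^sub>n\<close>.
  Adding the monotonicity inequalities of the two resolvent steps shows that, for every
  solution \<open>(x\<^sup>*, y\<^sup>*)\<close> of the system, the energy
  \<open>\<parallel>x\<^sub>n - x\<^sup>*\<parallel>\<^sup>2/2\<tau> + \<parallel>y\<^sub>n - y\<^sup>*\<parallel>\<^sup>2/2\<sigma> + \<langle>y\<^sub>n - y\<^sup>*, K d\<^sub>n\<rangle> + \<parallel>d\<^sub>n\<parallel>\<^sup>2/2\<tau>\<close>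
  decreases at each step by at least a multiple of \<open>\<parallel>d\<^sub>n\<parallel>\<^sup>2 + \<parallel>y\<^sub>n\<^sub>+\<^sub>1 - y\<^sub>n\<parallel>\<^sup>2\<close>, and it dominates
  the left-hand side of (i). Hence the increments vanish, every cluster point solves the
  system because graphs of maximally monotone operators are closed, and the energy taken with
  respect to a cluster point tends to \<open>0\<close> along a subsequence, hence along the full sequence.
\<close>

section \<open>Adjoints on Hilbert spaces\<close>

text \<open>The representing vector is the minimiser of \<open>\<parallel>x\<parallel>\<^sup>2 - 2 f x\<close>.\<close>

theorem riesz_representation:
  fixes f :: "'a::{real_inner, complete_space} \<Rightarrow> real"
  assumes f: "bounded_linear f"
  obtains z where "\<And>x. f x = inner x z"
proof -
  interpret f: bounded_linear f by (fact f)
  define J where "J v = inner v v - 2 * f v" for v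
  \<comment> \<open>Complete the square in \<open>norm v\<close>, using
    \<open>f v \<le> onorm f * norm v\<close>.\<close>
  have J_lower: "- (onorm f)\<^sup>2 \<le> J v" for v
  proof -
    have "f v \<le> onorm f * norm v"
      using onorm[OF f, of v] by simp
    moreover have "0 \<le> (norm v - onorm f)\<^sup>2"
      by simp
    ultimately show ?thesis
      by (simp add: J_def power2_diff power2_norm_eq_inner mult.commute mult.left_commute)
  qed
  define m where "m = Inf (range J)"
  have bdd: "bdd_below (range J)"
    by (rule bdd_belowI[of _ "- (onorm f)\<^sup>2"]) (use J_lower in auto)
  have m_le: "m \<le> J v" for v
    unfolding m_def using bdd by (auto intro: cInf_lower)
  have "\<exists>v. J v < m + 1 / real (Suc n)" for n
    using cInf_lessD[of "range J" "m + 1 / real (Suc n)"] by (auto simp: m_def)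
  then obtain v where v: "\<And>n. J (v n) < m + 1 / real (Suc n)"
    by metis
  \<comment> \<open>Parallelogram law: the linear parts of \<open>J\<close> cancel, and
    \<open>J\<close> at the midpoint is at least \<open>m\<close>. Near-minimisers are therefore
    close together, which makes \<open>v\<close> Cauchy.\<close>
  have parallelogram: "(norm (p - q))\<^sup>2 \<le> 2 * (J p - m) + 2 * (J q - m)" for p q
  proof -
    have "(norm (p - q))\<^sup>2 = 2 * J p + 2 * J q - 4 * J ((1/2) *\<^sub>R (p + q))"
      by (simp add: J_def power2_norm_eq_inner inner_simps f.add f.scaleR inner_commute
          algebra_simps)
    with m_le[of "(1/2) *\<^sub>R (p + q)"] show ?thesis by simp
  qed
  have lim0: "(\<lambda>n. 1 / real (Suc n)) \<longlonglongrightarrow> 0"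
    by (rule LIMSEQ_Suc[OF lim_1_over_n])
  have "Cauchy v"
  proof (rule metric_CauchyI)
    fix e :: real assume "0 < e"
    then have "\<forall>\<^sub>F n in sequentially. 1 / real (Suc n) < e\<^sup>2 / 4"
      by (intro order_tendstoD(2)[OF lim0]) simp
    then obtain N where N: "\<And>n. n \<ge> N \<Longrightarrow> 1 / real (Suc n) < e\<^sup>2 / 4"
      by (auto simp: eventually_sequentially)
    have J_less: "J (v i) < m + e\<^sup>2 / 4" if "i \<ge> N" for i
      by (rule less_trans[OF v[of i] add_strict_left_mono[OF N[OF that]]])
    have "dist (v i) (v j) < e" if "i \<ge> N" "j \<ge> N" for i j
    proof -
      note parallelogram[of "v i" "v j"]
      also have "2 * (J (v i) - m) + 2 * (J (v j) - m) < 2 * (e\<^sup>2 / 4) + 2 * (e\<^sup>2 / 4)"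
        using J_less[OF that(1)] J_less[OF that(2)]
        by (intro add_strict_mono mult_strict_left_mono) (simp_all add: diff_less_eq add.commute)
      also have "\<dots> = e\<^sup>2"
        by simp
      finally have "(norm (v i - v j))\<^sup>2 < e\<^sup>2" .
      then show ?thesis
        using \<open>0 < e\<close> by (simp add: dist_norm power2_less_imp_less)
    qed
    then show "\<exists>N. \<forall>i\<ge>N. \<forall>j\<ge>N. dist (v i) (v j) < e"
      by blast
  qed
  then obtain z where z: "v \<longlonglongrightarrow> z"
    using Cauchy_convergent_iff convergent_def by blast
  have "(\<lambda>n. J (v n)) \<longlonglongrightarrow> J z"
    unfolding J_def by (intro tendsto_intros f.tendsto z)
  moreover have "(\<lambda>n. m + 1 / real (Suc n)) \<longlonglongrightarrow> m + 0"
    by (intro tendsto_intros lim0)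
  ultimately have "J z \<le> m + 0"
    by (rule LIMSEQ_le) (use v less_imp_le in blast)
  then have z_min: "J z \<le> J w" for w
    using m_le[of w] by simp
  have "f w = inner w z" for w
  proof (cases "w = 0")
    case False
    define d where "d = inner w z - f w"
    define s where "s = inner w w"
    have "s > 0" using False by (simp add: s_def)
    \<comment> \<open>The quadratic in \<open>t\<close> is least at \<open>t = d / s\<close>, where
      it would undercut the minimum by \<open>d\<^sup>2 / s\<close> unless
      \<open>d = 0\<close>.\<close>
    have "J (z - t *\<^sub>R w) = J z - 2 * t * d + t\<^sup>2 * s" for t
      by (simp add: J_def d_def s_def inner_simps f.diff f.scaleR inner_commute
          power2_eq_square algebra_simps)
    then have "J (z - (d / s) *\<^sub>R w) = J z - d\<^sup>2 / s"
      using \<open>s > 0\<close> by (simp add: power2_eq_square)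
    then have "d\<^sup>2 / s \<le> 0"
      using z_min[of "z - (d / s) *\<^sub>R w"] by simp
    then have "d = 0"
      using \<open>s > 0\<close> by (simp add: divide_le_0_iff)
    then show ?thesis by (simp add: d_def)
  qed (simp add: f.zero)
  then show thesis by (rule that)
qed

text \<open>Since \<open>adjoint\<close> is a choice operator, some adjoint must first be exhibited.
  Riesz representation of \<open>v \<mapsto> inner (K v) w\<close> provides one, and uniqueness
  identifies it with the chosen one.\<close>

lemma inner_adjoint_right:
  fixes K :: "'a::{real_inner, complete_space} \<Rightarrow> 'b::real_inner"
  assumes "bounded_linear K"
  shows "inner v (adjoint K w) = inner (K v) w"
proof -
  have "\<exists>z. \<forall>v. inner (K v) w = inner v z" for w
  proof -
    have "bounded_linear (\<lambda>v. inner (K v) w)"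
      using bounded_linear_compose[OF bounded_linear_inner_left assms] .
    then show ?thesis
      by (rule riesz_representation) blast
  qed
  then obtain g where "\<forall>v w. inner (K v) w = inner v (g w)"
    by metis
  then show ?thesis
    using adjoint_unique[of K g] by simp
qed

section \<open>Maximally monotone operators\<close>

lemma maximally_monotoneD:
  assumes "maximally_monotone A" "u \<in> A x" "w \<in> A v"
  shows "0 \<le> inner (x - v) (u - w)"
proof -
  have "(x, u) \<in> op_graph A" "(v, w) \<in> op_graph A"
    using assms(2,3) by (simp_all add: op_graph_def)
  then show ?thesis
    using assms(1) unfolding maximally_monotone_def monotone_op_def by fastforce
qed

text \<open>Otherwise adjoining \<open>(x, u)\<close> to the graph would give a proper monotone
  extension. This is how limits of graph inequalities become memberships.\<close>

lemma maximally_monotone_memI: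
  assumes A: "maximally_monotone A"
    and *: "\<And>v w. w \<in> A v \<Longrightarrow> 0 \<le> inner (x - v) (u - w)"
  shows "u \<in> A x"
proof (rule ccontr)
  assume "u \<notin> A x"
  define A' where "A' = A(x := insert u (A x))"
  have "op_graph A \<subset> op_graph A'"
    using \<open>u \<notin> A x\<close> by (auto simp: op_graph_def A'_def)
  moreover have "monotone_op A'"
  proof -
    have "0 \<le> inner (p - v) (q - w)" if "q \<in> A' p" "w \<in> A' v" for p q v w
    proof -
      have "q \<in> A p \<or> p = x \<and> q = u" "w \<in> A v \<or> v = x \<and> w = u"
        using that by (auto simp: A'_def split: if_splits)
      moreover have "inner (p - x) (q - u) = inner (x - p) (u - q)"
        by (simp add: inner_simps)
      ultimately show ?thesis
        using *[of w v] *[of q p] maximally_monotoneD[OF A, of q p w v] by auto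
    qed
    then show ?thesis
      by (auto simp: monotone_op_def op_graph_def)
  qed
  ultimately show False
    using A by (auto simp: maximally_monotone_def)
qed

text \<open>Rewrites a resolvent step as a point of the graph of \<open>A\<close>, to which
  monotonicity applies.\<close>

lemma resolvent_op_scale_iff:
  assumes "c \<noteq> 0"
  shows "p \<in> resolvent (op_scale c A) q \<longleftrightarrow> (q - p) /\<^sub>R c \<in> A p"
proof
  assume "p \<in> resolvent (op_scale c A) q"
  then obtain u where "u \<in> A p" "q = p + c *\<^sub>R u"
    by (auto simp: resolvent_def op_inverse_def op_scale_def)
  then show "(q - p) /\<^sub>R c \<in> A p"
    using assms by simp
next
  assume "(q - p) /\<^sub>R c \<in> A p"
  moreover have "q = p + c *\<^sub>R ((q - p) /\<^sub>R c)"
    using assms by simp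
  ultimately show "p \<in> resolvent (op_scale c A) q"
    unfolding resolvent_def op_inverse_def op_scale_def by blast
qed

section \<open>Compactness in finite-dimensional inner product spaces\<close>

text \<open>The remainder lies in the span and is orthogonal to every element of \<open>C\<close>,
  hence to itself.\<close>

lemma finite_orthogonal_expansion:
  fixes x :: "'a::real_inner"
  assumes "finite C" "pairwise orthogonal C" "x \<in> span C"
  shows "x = (\<Sum>c\<in>C. (inner x c / inner c c) *\<^sub>R c)"
proof -
  define z where "z = x - (\<Sum>c\<in>C. (inner x c / inner c c) *\<^sub>R c)"
  have "z \<in> span C"
    unfolding z_def by (intro span_diff span_sum span_scale assms span_base)
  have "orthogonal z b" if "b \<in> C" for b
  proof -
    \<comment> \<open>\<open>C\<close> may contain \<open>0\<close>: that summand vanishes, in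
      agreement with \<open>inner x 0 = 0\<close>.\<close>
    have "inner (\<Sum>c\<in>C. (inner x c / inner c c) *\<^sub>R c) b
        = (\<Sum>c\<in>C. if c = b then inner x b else 0)"
      unfolding inner_sum_left
      using assms(2) that by (intro sum.cong) (auto simp: pairwise_def orthogonal_def)
    also have "\<dots> = inner x b"
      using assms(1) that by simp
    finally show ?thesis
      by (simp add: z_def orthogonal_def inner_diff_left)
  qed
  then have "orthogonal z z"
    using \<open>z \<in> span C\<close> orthogonal_to_span by blast
  then show ?thesis
    by (simp add: orthogonal_self z_def)
qed

text \<open>Each new vector of \<open>C\<close> costs one further extraction by Bolzano-Weierstrass
  in the reals, and the earlier limits survive it.\<close>

lemma bounded_imp_inner_convergent_subsequence:
  fixes f :: "nat \<Rightarrow> 'a::real_inner"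
  assumes "finite C" "bounded (range f)"
  shows "\<exists>r::nat \<Rightarrow> nat. strict_mono r \<and> (\<forall>c\<in>C. convergent (\<lambda>n. inner (f (r n)) c))"
  using assms(1)
proof induction
  case empty
  then show ?case using strict_mono_id by blast
next
  case (insert c C)
  then obtain r :: "nat \<Rightarrow> nat"
    where r: "strict_mono r" "\<And>b. b \<in> C \<Longrightarrow> convergent (\<lambda>n. inner (f (r n)) b)"
    by blast
  have "bounded ((\<lambda>v. inner v c) ` range f)"
    using assms(2) bounded_linear_inner_left by (rule bounded_linear_image)
  then have "bounded (range (\<lambda>n. inner (f (r n)) c))"
    by (rule bounded_subset) auto
  then obtain l s where s: "strict_mono s" "((\<lambda>n. inner (f (r n)) c) \<circ> s) \<longlonglongrightarrow> l"
    using bounded_imp_convergent_subsequence by blast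
  have "convergent (\<lambda>n. inner (f ((r \<circ> s) n)) b)" if "b \<in> insert c C" for b
  proof (cases "b = c")
    case True
    then show ?thesis using s(2) by (auto simp: convergent_def o_def)
  next
    case False
    then have "convergent (\<lambda>n. inner (f (r n)) b)" using r(2) that by blast
    from convergent_subseq_convergent[OF this s(1)] show ?thesis by (simp add: o_def)
  qed
  moreover have "strict_mono (r \<circ> s)"
    using r(1) s(1) by (rule strict_mono_o)
  ultimately show ?case by blast
qed

text \<open>The coordinates in a finite orthogonal spanning set converge along a common subsequence,
  and the orthogonal expansion assembles their limits.\<close>

lemma finite_dimensional_bounded_imp_convergent_subsequence:
  fixes f :: "nat \<Rightarrow> 'a::real_inner"
  assumes "finite_dimensional_space TYPE('a)" "bounded (range f)"
  obtains l and r :: "nat \<Rightarrow> nat" where "strict_mono r" "(f \<circ> r) \<longlonglongrightarrow> l"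
proof -
  obtain C :: "'a set" where C: "finite C" "span C = UNIV" "pairwise orthogonal C"
    using assms(1) basis_orthogonal unfolding finite_dimensional_space_def by metis
  obtain r :: "nat \<Rightarrow> nat" and l
    where r: "strict_mono r" "\<And>c. c \<in> C \<Longrightarrow> (\<lambda>n. inner (f (r n)) c) \<longlonglongrightarrow> l c"
    using bounded_imp_inner_convergent_subsequence[OF C(1) assms(2)]
    unfolding convergent_def by metis
  have "f \<circ> r = (\<lambda>n. \<Sum>c\<in>C. (inner (f (r n)) c / inner c c) *\<^sub>R c)"
    using finite_orthogonal_expansion[OF C(1,3)] C(2) by auto
  moreover have "(\<lambda>n. \<Sum>c\<in>C. (inner (f (r n)) c / inner c c) *\<^sub>R c)
      \<longlonglongrightarrow> (\<Sum>c\<in>C. (l c / inner c c) *\<^sub>R c)"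
    unfolding divide_inverse by (intro tendsto_intros r(2))
  ultimately show thesis
    using that r(1) by simp
qed

section \<open>The primal-dual iteration\<close>

text \<open>
  Truncated subtraction makes the increment \<open>x n - x (n - 1)\<close> vanish for \<open>n = 0\<close>, which
  encodes the initialisation of the extrapolated point by \<open>x 0\<close>.
\<close>

locale primal_dual_iteration =
  fixes A :: "'a::{real_inner, complete_space} \<Rightarrow> 'a set"
    and B :: "'b::{real_inner, complete_space} \<Rightarrow> 'b set"
    and K :: "'a \<Rightarrow> 'b"
    and \<sigma> \<tau> :: real
    and x :: "nat \<Rightarrow> 'a" and y :: "nat \<Rightarrow> 'b"
  assumes maxmono_A: "maximally_monotone A"
    and maxmono_B: "maximally_monotone B"
    and bounded_linear_K: "bounded_linear K"
    and \<sigma>_pos: "\<sigma> > 0" and \<tau>_pos: "\<tau> > 0"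
    and step_size: "\<sigma> * \<tau> * (onorm K)\<^sup>2 < 1"
    and y_step: "K (x n + (x n - x (n - 1))) - (y (Suc n) - y n) /\<^sub>R \<sigma> \<in> op_inverse B (y (Suc n))"
    and x_step: "- adjoint K (y (Suc n)) - (x (Suc n) - x n) /\<^sub>R \<tau> \<in> A (x (Suc n))"
begin

sublocale K: bounded_linear K
  by (fact bounded_linear_K)

text \<open>The inner product carries the extrapolation term from one step to the next, so that it
  telescopes; the last square compensates for its unknown sign.\<close>

definition energy :: "'a \<Rightarrow> 'b \<Rightarrow> nat \<Rightarrow> real" where
  "energy p q n = (norm (x n - p))\<^sup>2 / (2 * \<tau>) + (norm (y n - q))\<^sup>2 / (2 * \<sigma>)
     + inner (y n - q) (K (x n - x (n - 1))) + (norm (x n - x (n - 1)))\<^sup>2 / (2 * \<tau>)"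

text \<open>This is the norm of \<open>K\<close> scaled by \<open>sqrt (\<sigma> * \<tau>)\<close>;
  the step size condition says that it is below 1.\<close>

definition \<theta> :: real where
  "\<theta> = sqrt (\<sigma> * \<tau>) * onorm K"

section \<open>Young-type bounds for the coupling term\<close>

lemma \<theta>_nonneg: "0 \<le> \<theta>"
  using \<sigma>_pos \<tau>_pos by (simp add: \<theta>_def onorm_pos_le[OF bounded_linear_K])

lemma \<theta>_squared: "\<theta>\<^sup>2 = \<sigma> * \<tau> * (onorm K)\<^sup>2"
  using \<sigma>_pos \<tau>_pos by (simp add: \<theta>_def power_mult_distrib)

lemma \<theta>_less_1: "\<theta> < 1"
  using step_size power2_less_imp_less[of \<theta> 1] by (simp add: \<theta>_squared)

text \<open>Cauchy-Schwarz in rescaled norms. The factor 2 prepares for bounding twice a product by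
  a sum of squares.\<close>

lemma inner_K_bound:
  "\<bar>inner v (K u)\<bar> \<le> \<theta> * (2 * (norm v / sqrt (2 * \<sigma>)) * (norm u / sqrt (2 * \<tau>)))"
proof -
  have "\<bar>inner v (K u)\<bar> \<le> norm v * norm (K u)"
    by (rule Cauchy_Schwarz_ineq2)
  also have "\<dots> \<le> norm v * (onorm K * norm u)"
    by (intro mult_left_mono onorm[OF bounded_linear_K] norm_ge_zero)
  also have "\<dots> = \<theta> * (2 * (norm v / sqrt (2 * \<sigma>)) * (norm u / sqrt (2 * \<tau>)))"
    using \<sigma>_pos \<tau>_pos by (simp add: \<theta>_def real_sqrt_mult)
  finally show ?thesis .
qed

lemma norm_div_sqrt_squared: "(norm v / sqrt (2 * \<rho>))\<^sup>2 = (norm v)\<^sup>2 / (2 * \<rho>)" if "\<rho> > 0" for \<rho> :: real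
  using that by (simp add: power_divide)

text \<open>The balanced form leaves the fraction \<open>1 - \<theta>\<close> of both squared
  increments in the descent estimate.\<close>

lemma inner_K_young:
  "\<bar>inner v (K u)\<bar> \<le> \<theta> * ((norm v)\<^sup>2 / (2 * \<sigma>) + (norm u)\<^sup>2 / (2 * \<tau>))"
proof -
  have "2 * (norm v / sqrt (2 * \<sigma>)) * (norm u / sqrt (2 * \<tau>))
      \<le> (norm v)\<^sup>2 / (2 * \<sigma>) + (norm u)\<^sup>2 / (2 * \<tau>)"
    using sum_squares_bound[of "norm v / sqrt (2 * \<sigma>)" "norm u / sqrt (2 * \<tau>)"]
    unfolding norm_div_sqrt_squared[OF \<sigma>_pos] norm_div_sqrt_squared[OF \<tau>_pos] .
  from mult_left_mono[OF this \<theta>_nonneg] inner_K_bound[of v u] show ?thesis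
    by linarith
qed

text \<open>All of the smallness is put on \<open>v\<close>: the square of \<open>u\<close> then
  cancels the last term of the energy exactly, and the factor in (i) appears.\<close>

lemma inner_K_young_unbalanced:
  "\<bar>inner v (K u)\<bar> \<le> \<sigma> * \<tau> * (onorm K)\<^sup>2 * ((norm v)\<^sup>2 / (2 * \<sigma>)) + (norm u)\<^sup>2 / (2 * \<tau>)"
proof -
  have "\<theta> * (2 * (norm v / sqrt (2 * \<sigma>)) * (norm u / sqrt (2 * \<tau>)))
      \<le> \<theta>\<^sup>2 * (norm v / sqrt (2 * \<sigma>))\<^sup>2 + (norm u / sqrt (2 * \<tau>))\<^sup>2"
    using sum_squares_bound[of "\<theta> * (norm v / sqrt (2 * \<sigma>))" "norm u / sqrt (2 * \<tau>)"]
    unfolding power_mult_distrib by (simp only: ac_simps)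
  then show ?thesis
    using inner_K_bound[of v u]
    unfolding norm_div_sqrt_squared[OF \<sigma>_pos] norm_div_sqrt_squared[OF \<tau>_pos] \<theta>_squared by linarith
qed

section \<open>Lower bound and descent of the energy\<close>

lemma energy_lower_bound:
  "(norm (x n - p))\<^sup>2 / (2 * \<tau>) + (1 - \<sigma> * \<tau> * (onorm K)\<^sup>2) * ((norm (y n - q))\<^sup>2 / (2 * \<sigma>))
    \<le> energy p q n"
proof -
  have "- inner (y n - q) (K (x n - x (n - 1)))
      \<le> \<sigma> * \<tau> * (onorm K)\<^sup>2 * ((norm (y n - q))\<^sup>2 / (2 * \<sigma>))
        + (norm (x n - x (n - 1)))\<^sup>2 / (2 * \<tau>)"
    using inner_K_young_unbalanced[of "y n - q" "x n - x (n - 1)"] by linarith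
  then show ?thesis
    unfolding energy_def left_diff_distrib by linarith
qed

lemma energy_nonneg: "0 \<le> energy p q n"
proof -
  have "0 \<le> (norm (x n - p))\<^sup>2 / (2 * \<tau>)
      + (1 - \<sigma> * \<tau> * (onorm K)\<^sup>2) * ((norm (y n - q))\<^sup>2 / (2 * \<sigma>))"
    using \<sigma>_pos \<tau>_pos step_size by (intro add_nonneg_nonneg mult_nonneg_nonneg) auto
  then show ?thesis
    using energy_lower_bound order_trans by blast
qed

text \<open>As \<open>0 - 1 = 0\<close> on naturals, the increment terms vanish and the right-hand
  side of (i) remains.\<close>

lemma energy_0: "energy p q 0 = (norm (x 0 - p))\<^sup>2 / (2 * \<tau>) + (norm (y 0 - q))\<^sup>2 / (2 * \<sigma>)"
  by (simp add: energy_def K.zero)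

text \<open>The test point is arbitrary, to serve both the descent at a solution and the limit at a
  cluster point. With the adjoint moved over to \<open>K\<close>, the limit only requires continuity
  of \<open>K\<close>.\<close>

lemma x_step_inequality:
  assumes "w \<in> A v"
  shows "0 \<le> inner (x (Suc n) - v) (- w - (x (Suc n) - x n) /\<^sub>R \<tau>)
    - inner (K (x (Suc n) - v)) (y (Suc n))"
  using maximally_monotoneD[OF maxmono_A x_step[of n] assms]
  by (simp add: inner_diff_right inner_adjoint_right[OF bounded_linear_K])

text \<open>The membership in \<open>op_inverse B\<close> is read as a point of the graph of
  \<open>B\<close>, so only the monotonicity of \<open>B\<close> itself enters.\<close>

lemma y_step_inequality:
  assumes "w \<in> B v"
  shows "0 \<le> inner (K (x n + (x n - x (n - 1))) - (y (Suc n) - y n) /\<^sub>R \<sigma> - v) (y (Suc n) - w)"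
  using maximally_monotoneD[OF maxmono_B _ assms] y_step[of n] by (simp add: op_inverse_def)

lemma energy_Suc:
  assumes "inclusion_solution A B K p q"
  shows "energy p q (Suc n) + (1 - \<theta>) *
      ((norm (y (Suc n) - y n))\<^sup>2 / (2 * \<sigma>) + (norm (x n - x (n - 1)))\<^sup>2 / (2 * \<tau>))
    \<le> energy p q n"
proof -
  define a b d a' b' where "a = x n - p" and "b = y n - q" and "d = x n - x (n - 1)"
    and "a' = x (Suc n) - p" and "b' = y (Suc n) - q"
  have diffs: "x (Suc n) - x n = a' - a" "y (Suc n) - y n = b' - b"
    by (simp_all add: a_def a'_def b_def b'_def)
  have "q \<in> B (K p)" "- adjoint K q \<in> A p"
    using assms by (auto simp: inclusion_solution_def op_inverse_def)
  have "0 \<le> - inner a' (a' - a) / \<tau> - inner (K a') b'"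
    using x_step_inequality[OF \<open>- adjoint K q \<in> A p\<close>, of n]
    unfolding diffs a'_def[symmetric]
    by (simp add: b'_def inner_diff_right inner_adjoint_right[OF bounded_linear_K] divide_inverse
        algebra_simps)
  \<comment> \<open>Polarisation turns the inner product into a difference of squared distances that
    telescopes.\<close>
  also have "- inner a' (a' - a) = ((norm a)\<^sup>2 - (norm a')\<^sup>2 - (norm (a' - a))\<^sup>2) / 2"
    by (simp add: power2_norm_eq_inner inner_diff_left inner_diff_right inner_commute)
  finally have X: "0 \<le> ((norm a)\<^sup>2 - (norm a')\<^sup>2 - (norm (a' - a))\<^sup>2) / (2 * \<tau>) - inner b' (K a')"
    by (simp add: inner_commute)
  have "K (x n + (x n - x (n - 1))) - (b' - b) /\<^sub>R \<sigma> - K p = K (a + d) - (b' - b) /\<^sub>R \<sigma>"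
    by (simp add: a_def d_def K.add K.diff)
  then have "0 \<le> - inner b' (b' - b) / \<sigma> + inner b' (K (a + d))"
    using y_step_inequality[OF \<open>q \<in> B (K p)\<close>, of n]
    unfolding diffs b'_def[symmetric]
    by (simp add: inner_diff_left inner_commute divide_inverse algebra_simps)
  also have "- inner b' (b' - b) = ((norm b)\<^sup>2 - (norm b')\<^sup>2 - (norm (b' - b))\<^sup>2) / 2"
    by (simp add: power2_norm_eq_inner inner_diff_left inner_diff_right inner_commute)
  finally have Y: "0 \<le> ((norm b)\<^sup>2 - (norm b')\<^sup>2 - (norm (b' - b))\<^sup>2) / (2 * \<sigma>)
      + inner b' (K (a + d))"
    by simp
  define R where "R = (norm (b' - b))\<^sup>2 / (2 * \<sigma>) + (norm d)\<^sup>2 / (2 * \<tau>)"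
  \<comment> \<open>Here \<open>a + d - a' = d - (a' - a)\<close>. The first and last terms on the
    right are the coupling terms of the energies at \<open>n\<close> and \<open>Suc n\<close>; only
    the middle one, a product of increments, needs an estimate.\<close>
  have "inner b' (K (a + d)) - inner b' (K a')
      = inner b (K d) + inner (b' - b) (K d) - inner b' (K (a' - a))"
    by (simp add: K.add K.diff inner_diff_left inner_add_right inner_diff_right)
  moreover have "inner (b' - b) (K d) \<le> \<theta> * R"
    using inner_K_young[of "b' - b" d] unfolding R_def by linarith
  moreover have "energy p q (Suc n) = (norm a')\<^sup>2 / (2 * \<tau>) + (norm b')\<^sup>2 / (2 * \<sigma>)
      + inner b' (K (a' - a)) + (norm (a' - a))\<^sup>2 / (2 * \<tau>)"
    by (simp add: energy_def diffs flip: a'_def b'_def)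
  moreover have "energy p q n = (norm a)\<^sup>2 / (2 * \<tau>) + (norm b)\<^sup>2 / (2 * \<sigma>)
      + inner b (K d) + (norm d)\<^sup>2 / (2 * \<tau>)"
    by (simp add: energy_def a_def b_def d_def)
  ultimately have "energy p q (Suc n) + (R - \<theta> * R) \<le> energy p q n"
    using X Y R_def unfolding diff_divide_distrib by linarith
  then show ?thesis
    unfolding diffs d_def[symmetric] R_def[symmetric] by (simp add: left_diff_distrib)
qed

lemma decseq_energy:
  assumes "inclusion_solution A B K p q"
  shows "decseq (energy p q)"
proof (rule decseq_SucI)
  fix n
  have "0 \<le> (1 - \<theta>) *
      ((norm (y (Suc n) - y n))\<^sup>2 / (2 * \<sigma>) + (norm (x n - x (n - 1)))\<^sup>2 / (2 * \<tau>))"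
    using \<theta>_less_1 \<sigma>_pos \<tau>_pos by (intro mult_nonneg_nonneg add_nonneg_nonneg) auto
  with energy_Suc[OF assms, of n] show "energy p q (Suc n) \<le> energy p q n"
    by linarith
qed

section \<open>Consequences of the descent: bounds and vanishing increments\<close>

lemma convergent_energy:
  assumes "inclusion_solution A B K p q"
  shows "convergent (energy p q)"
proof (rule Bseq_monoseq_convergent)
  show "Bseq (energy p q)"
    using decseq_energy[OF assms] by (rule decseq_bounded[where B = 0]) (simp add: energy_nonneg)
  show "monoseq (energy p q)"
    by (rule decseq_imp_monoseq[OF decseq_energy[OF assms]])
qed

lemma distance_bound:
  assumes "inclusion_solution A B K p q"
  shows "(norm (x n - p))\<^sup>2 / (2 * \<tau>)
      + (1 - \<sigma> * \<tau> * (onorm K)\<^sup>2) * ((norm (y n - q))\<^sup>2 / (2 * \<sigma>))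
    \<le> (norm (x 0 - p))\<^sup>2 / (2 * \<tau>) + (norm (y 0 - q))\<^sup>2 / (2 * \<sigma>)"
  using energy_lower_bound[of n p q] decseqD[OF decseq_energy[OF assms], of 0 n]
  by (simp add: energy_0)

lemma norm_le_energy:
  "(norm (x n - p))\<^sup>2 \<le> 2 * \<tau> * energy p q n"
  "(norm (y n - q))\<^sup>2 \<le> 2 * \<sigma> / (1 - \<sigma> * \<tau> * (onorm K)\<^sup>2) * energy p q n"
proof -
  define \<kappa> where "\<kappa> = 1 - \<sigma> * \<tau> * (onorm K)\<^sup>2"
  have \<kappa>: "\<kappa> > 0" using step_size by (simp add: \<kappa>_def)
  have bound: "(norm (x n - p))\<^sup>2 / (2 * \<tau>) + \<kappa> * ((norm (y n - q))\<^sup>2 / (2 * \<sigma>)) \<le> energy p q n"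
    using energy_lower_bound[of n p q] by (simp add: \<kappa>_def)
  have nonneg: "0 \<le> (norm (x n - p))\<^sup>2 / (2 * \<tau>)" "0 \<le> \<kappa> * ((norm (y n - q))\<^sup>2 / (2 * \<sigma>))"
    using \<kappa> \<sigma>_pos \<tau>_pos by auto
  have "(norm (x n - p))\<^sup>2 / (2 * \<tau>) \<le> energy p q n"
    using bound nonneg by linarith
  then show "(norm (x n - p))\<^sup>2 \<le> 2 * \<tau> * energy p q n"
    using \<tau>_pos by (simp add: pos_divide_le_eq mult.commute)
  have "\<kappa> * ((norm (y n - q))\<^sup>2 / (2 * \<sigma>)) \<le> energy p q n"
    using bound nonneg by linarith
  then show "(norm (y n - q))\<^sup>2 \<le> 2 * \<sigma> / (1 - \<sigma> * \<tau> * (onorm K)\<^sup>2) * energy p q n"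
    unfolding \<kappa>_def[symmetric] using \<kappa> \<sigma>_pos by (simp add: field_simps)
qed

lemma bounded_iterates:
  assumes "inclusion_solution A B K p q"
  shows "bounded (range x)" "bounded (range y)"
proof -
  have le: "energy p q n \<le> energy p q 0" for n
    using decseqD[OF decseq_energy[OF assms]] by simp
  have "norm (x n - p) \<le> sqrt (2 * \<tau> * energy p q 0)" for n
    using norm_le_energy(1)[of n p q] mult_left_mono[OF le[of n], of "2 * \<tau>"] \<tau>_pos
    by (intro real_le_rsqrt) linarith
  then have "range x \<subseteq> cball p (sqrt (2 * \<tau> * energy p q 0))"
    by (auto simp: dist_norm norm_minus_commute)
  then show "bounded (range x)"
    by (rule bounded_subset[OF bounded_cball])
  define c where "c = 2 * \<sigma> / (1 - \<sigma> * \<tau> * (onorm K)\<^sup>2)"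
  have "c \<ge> 0"
    using \<sigma>_pos step_size by (simp add: c_def)
  have "norm (y n - q) \<le> sqrt (c * energy p q 0)" for n
    using norm_le_energy(2)[of n q p] mult_left_mono[OF le[of n] \<open>c \<ge> 0\<close>]
    by (intro real_le_rsqrt) (simp add: c_def)
  then have "range y \<subseteq> cball q (sqrt (c * energy p q 0))"
    by (auto simp: dist_norm norm_minus_commute)
  then show "bounded (range y)"
    by (rule bounded_subset[OF bounded_cball])
qed

text \<open>The gaps of the convergent energy tend to 0, and they dominate the squared increments
  because \<open>\<theta> < 1\<close>.\<close>

lemma increments_tendsto_0:
  assumes "inclusion_solution A B K p q"
  shows "(\<lambda>n. x n - x (n - 1)) \<longlonglongrightarrow> 0" "(\<lambda>n. y (Suc n) - y n) \<longlonglongrightarrow> 0"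
proof -
  define E where "E = energy p q"
  obtain L where L: "E \<longlonglongrightarrow> L"
    using convergent_energy[OF assms] by (auto simp: convergent_def E_def)
  have "(\<lambda>n. E n - E (Suc n)) \<longlonglongrightarrow> L - L"
    by (intro tendsto_diff L LIMSEQ_Suc)
  then have gap: "(\<lambda>n. c * (E n - E (Suc n))) \<longlonglongrightarrow> 0" for c
    using tendsto_mult_left[of _ 0 _ c] by simp
  have bound: "(norm (y (Suc n) - y n))\<^sup>2 / (2 * \<sigma>) + (norm (x n - x (n - 1)))\<^sup>2 / (2 * \<tau>)
      \<le> (E n - E (Suc n)) / (1 - \<theta>)" for n
    using energy_Suc[OF assms, of n] \<theta>_less_1
    by (simp add: E_def pos_le_divide_eq algebra_simps)
  have sq_tendsto: "f \<longlonglongrightarrow> 0"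
    if "\<rho> > 0" "\<And>n. (norm (f n))\<^sup>2 / (2 * \<rho>) \<le> (E n - E (Suc n)) / (1 - \<theta>)"
    for f :: "nat \<Rightarrow> 'c::real_normed_vector" and \<rho> :: real
  proof -
    have "(norm (f n))\<^sup>2 \<le> 2 * \<rho> / (1 - \<theta>) * (E n - E (Suc n))" for n
      using that(2)[of n] \<open>\<rho> > 0\<close> by (simp add: pos_divide_le_eq algebra_simps)
    then have "(\<lambda>n. (norm (f n))\<^sup>2) \<longlonglongrightarrow> 0"
      by (intro tendsto_sandwich[OF _ _ tendsto_const gap[of "2 * \<rho> / (1 - \<theta>)"]] always_eventually)
        auto
    then show ?thesis
      using tendsto_real_sqrt[of "\<lambda>n. (norm (f n))\<^sup>2" 0] by (simp add: tendsto_norm_zero_iff)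
  qed
  show "(\<lambda>n. x n - x (n - 1)) \<longlonglongrightarrow> 0"
  proof (rule sq_tendsto[OF \<tau>_pos])
    fix n
    have "0 \<le> (norm (y (Suc n) - y n))\<^sup>2 / (2 * \<sigma>)" using \<sigma>_pos by simp
    with bound[of n]
    show "(norm (x n - x (n - 1)))\<^sup>2 / (2 * \<tau>) \<le> (E n - E (Suc n)) / (1 - \<theta>)" by linarith
  qed
  show "(\<lambda>n. y (Suc n) - y n) \<longlonglongrightarrow> 0"
  proof (rule sq_tendsto[OF \<sigma>_pos])
    fix n
    have "0 \<le> (norm (x n - x (n - 1)))\<^sup>2 / (2 * \<tau>)" using \<tau>_pos by simp
    with bound[of n]
    show "(norm (y (Suc n) - y n))\<^sup>2 / (2 * \<sigma>) \<le> (E n - E (Suc n)) / (1 - \<theta>)" by linarith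
  qed
qed

section \<open>Cluster points and convergence\<close>

lemma cluster_point_solution:
  assumes sol: "inclusion_solution A B K p q" and r: "strict_mono r"
    and x_lim: "(\<lambda>n. x (r n)) \<longlonglongrightarrow> xs" and y_lim: "(\<lambda>n. y (r n)) \<longlonglongrightarrow> ys"
  shows "inclusion_solution A B K xs ys"
proof -
  have sub: "(\<lambda>n. f (r n)) \<longlonglongrightarrow> l" if "f \<longlonglongrightarrow> l" for f :: "nat \<Rightarrow> 'c::topological_space" and l
    using LIMSEQ_subseq_LIMSEQ[OF that r] by (simp add: o_def)
  \<comment> \<open>The backward increment enters through the extrapolated point, the forward
    increments through the two resolvent steps; the forward one of \<open>x\<close> is the backward
    one shifted by an index.\<close>
  have dx: "(\<lambda>n. x (r n) - x (r n - 1)) \<longlonglongrightarrow> 0"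
    using sub[OF increments_tendsto_0(1)[OF sol]] .
  have dx': "(\<lambda>n. x (Suc (r n)) - x (r n)) \<longlonglongrightarrow> 0"
    using sub[OF LIMSEQ_Suc[OF increments_tendsto_0(1)[OF sol]]] by simp
  have dy: "(\<lambda>n. y (Suc (r n)) - y (r n)) \<longlonglongrightarrow> 0"
    using sub[OF increments_tendsto_0(2)[OF sol]] .
  have x_lim': "(\<lambda>n. x (Suc (r n))) \<longlonglongrightarrow> xs" and y_lim': "(\<lambda>n. y (Suc (r n))) \<longlonglongrightarrow> ys"
    using tendsto_add[OF dx' x_lim] tendsto_add[OF dy y_lim] by simp_all
  have "- adjoint K ys \<in> A xs"
  proof (rule maximally_monotone_memI[OF maxmono_A])
    fix v w assume "w \<in> A v"
    \<comment> \<open>The step inequality against a fixed graph point passes to the limit;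
      maximality turns the limiting inequality into membership.\<close>
    have "(\<lambda>n. inner (x (Suc (r n)) - v) (- w - (x (Suc (r n)) - x (r n)) /\<^sub>R \<tau>)
          - inner (K (x (Suc (r n)) - v)) (y (Suc (r n))))
        \<longlonglongrightarrow> inner (xs - v) (- w - 0 /\<^sub>R \<tau>) - inner (K (xs - v)) ys"
      by (intro tendsto_intros K.tendsto x_lim' y_lim' dx')
    then have "0 \<le> inner (xs - v) (- w - 0 /\<^sub>R \<tau>) - inner (K (xs - v)) ys"
      by (rule LIMSEQ_le_const) (use x_step_inequality[OF \<open>w \<in> A v\<close>] in blast)
    then show "0 \<le> inner (xs - v) (- adjoint K ys - w)"
      by (simp add: inner_diff_right inner_adjoint_right[OF bounded_linear_K])
  qed
  moreover have "ys \<in> B (K xs)"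
  proof (rule maximally_monotone_memI[OF maxmono_B])
    fix v w assume "w \<in> B v"
    have "(\<lambda>n. inner (K (x (r n) + (x (r n) - x (r n - 1))) - (y (Suc (r n)) - y (r n)) /\<^sub>R \<sigma> - v)
          (y (Suc (r n)) - w))
        \<longlonglongrightarrow> inner (K (xs + 0) - 0 /\<^sub>R \<sigma> - v) (ys - w)"
      by (intro tendsto_intros K.tendsto x_lim dx dy y_lim')
    then have "0 \<le> inner (K (xs + 0) - 0 /\<^sub>R \<sigma> - v) (ys - w)"
      by (rule LIMSEQ_le_const) (use y_step_inequality[OF \<open>w \<in> B v\<close>] in blast)
    then show "0 \<le> inner (K xs - v) (ys - w)"
      by simp
  qed
  ultimately show ?thesis
    by (simp add: inclusion_solution_def op_inverse_def)
qed

text \<open>The energy relative to the cluster point converges because that point is a solution. Its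
  limit is 0 along \<open>r\<close>, hence 0 altogether, and the energy controls both
  distances.\<close>

lemma convergent_to_cluster_point:
  assumes sol: "inclusion_solution A B K xs ys" and r: "strict_mono r"
    and x_lim: "(\<lambda>n. x (r n)) \<longlonglongrightarrow> xs" and y_lim: "(\<lambda>n. y (r n)) \<longlonglongrightarrow> ys"
  shows "x \<longlonglongrightarrow> xs" "y \<longlonglongrightarrow> ys"
proof -
  have dx: "(\<lambda>n. x (r n) - x (r n - 1)) \<longlonglongrightarrow> 0"
    using LIMSEQ_subseq_LIMSEQ[OF increments_tendsto_0(1)[OF sol] r] by (simp add: o_def)
  have "(\<lambda>n. energy xs ys (r n)) \<longlonglongrightarrow> (norm (xs - xs))\<^sup>2 / (2 * \<tau>) + (norm (ys - ys))\<^sup>2 / (2 * \<sigma>)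
     + inner (ys - ys) (K 0) + (norm (0::'a))\<^sup>2 / (2 * \<tau>)"
    unfolding energy_def using \<sigma>_pos \<tau>_pos
    by (intro tendsto_intros K.tendsto x_lim y_lim dx) auto
  then have sub: "(energy xs ys \<circ> r) \<longlonglongrightarrow> 0"
    by (simp add: o_def)
  obtain L where L: "energy xs ys \<longlonglongrightarrow> L"
    using convergent_energy[OF sol] by (auto simp: convergent_def)
  have "L = 0"
    using LIMSEQ_unique[OF LIMSEQ_subseq_LIMSEQ[OF L r] sub] .
  with L have scaled: "(\<lambda>n. c * energy xs ys n) \<longlonglongrightarrow> 0" for c
    using tendsto_mult_left[of _ 0 _ c] by simp
  have sq_tendsto: "f \<longlonglongrightarrow> l" if "\<And>n. (norm (f n - l))\<^sup>2 \<le> c * energy xs ys n"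
    for f :: "nat \<Rightarrow> 'c::real_normed_vector" and l c
  proof -
    have "(\<lambda>n. (norm (f n - l))\<^sup>2) \<longlonglongrightarrow> 0"
      using that by (intro tendsto_sandwich[OF _ _ tendsto_const scaled[of c]] always_eventually) auto
    then show ?thesis
      using tendsto_real_sqrt[of "\<lambda>n. (norm (f n - l))\<^sup>2" 0]
      by (simp add: tendsto_norm_zero_iff LIM_zero_iff)
  qed
  show "x \<longlonglongrightarrow> xs" "y \<longlonglongrightarrow> ys"
    by (rule sq_tendsto, rule norm_le_energy)+
qed

lemma convergence:
  assumes sol: "inclusion_solution A B K p q"
    and fin: "finite_dimensional_space TYPE('a)" "finite_dimensional_space TYPE('b)"
  obtains xs ys where "inclusion_solution A B K xs ys" "x \<longlonglongrightarrow> xs" "y \<longlonglongrightarrow> ys"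
proof -
  obtain xs r where r: "strict_mono r" "(x \<circ> r) \<longlonglongrightarrow> xs"
    using finite_dimensional_bounded_imp_convergent_subsequence[OF fin(1) bounded_iterates(1)[OF sol]]
    by blast
  \<comment> \<open>The second extraction is made from \<open>y \<circ> r\<close>, so that both
    components converge along \<open>r \<circ> s\<close>.\<close>
  have "bounded (range (y \<circ> r))"
    by (rule bounded_subset[OF bounded_iterates(2)[OF sol]]) auto
  then obtain ys s where s: "strict_mono s" "((y \<circ> r) \<circ> s) \<longlonglongrightarrow> ys"
    using finite_dimensional_bounded_imp_convergent_subsequence[OF fin(2)] by blast
  have rs: "strict_mono (r \<circ> s)"
    using r(1) s(1) by (rule strict_mono_o)
  have lims: "(\<lambda>n. x ((r \<circ> s) n)) \<longlonglongrightarrow> xs" "(\<lambda>n. y ((r \<circ> s) n)) \<longlonglongrightarrow> ys"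
    using LIMSEQ_subseq_LIMSEQ[OF r(2) s(1)] s(2) by (simp_all add: o_def)
  have "inclusion_solution A B K xs ys"
    using cluster_point_solution[OF sol rs lims] .
  then show thesis
    using convergent_to_cluster_point[OF _ rs lims] that by blast
qed

end

section \<open>From the resolvent recursion to the abstract iteration\<close>

theorem theorem2:
  fixes A :: "'a::{real_inner, complete_space} \<Rightarrow> 'a set"
    and B :: "'b::{real_inner, complete_space} \<Rightarrow> 'b set"
    and K :: "'a \<Rightarrow> 'b"
    and xhat :: 'a and yhat :: 'b
    and \<sigma> \<tau> :: real
    and x xbar :: "nat \<Rightarrow> 'a" and y :: "nat \<Rightarrow> 'b"
  assumes "maximally_monotone A"
    and "maximally_monotone B"
    and "bounded_linear K"
    and "inclusion_solution A B K xhat yhat"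
    and "\<sigma> > 0" and "\<tau> > 0"
    and "\<sigma> * \<tau> * (onorm K)\<^sup>2 < 1"
    and "xbar 0 = x 0"
    and "\<And>n. y (Suc n) \<in> resolvent (op_scale \<sigma> (op_inverse B)) (y n + \<sigma> *\<^sub>R K (xbar n))"
    and "\<And>n. x (Suc n) \<in> resolvent (op_scale \<tau> A) (x n - \<tau> *\<^sub>R adjoint K (y (Suc n)))"
    and "\<And>n. xbar (Suc n) = 2 *\<^sub>R x (Suc n) - x n"
  shows "(\<forall>n. (norm (x n - xhat))\<^sup>2 / (2 * \<tau>)
            + (1 - \<sigma> * \<tau> * (onorm K)\<^sup>2) * ((norm (y n - yhat))\<^sup>2 / (2 * \<sigma>))
          \<le> (norm (x 0 - xhat))\<^sup>2 / (2 * \<tau>) + (norm (y 0 - yhat))\<^sup>2 / (2 * \<sigma>))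
      \<and> bounded (range (\<lambda>n. (x n, y n)))
      \<and> (finite_dimensional_space TYPE('a) \<and> finite_dimensional_space TYPE('b) \<longrightarrow>
          (\<exists>xs ys. inclusion_solution A B K xs ys \<and> (\<lambda>n. (x n, y n)) \<longlonglongrightarrow> (xs, ys)))"
proof -
  have xbar: "xbar n = x n + (x n - x (n - 1))" for n
    using assms(8,11) by (cases n) (simp_all add: scaleR_2)
  interpret primal_dual_iteration A B K \<sigma> \<tau> x y
  proof (rule primal_dual_iteration.intro)
    fix n
    have "(y n + \<sigma> *\<^sub>R K (xbar n) - y (Suc n)) /\<^sub>R \<sigma> \<in> op_inverse B (y (Suc n))"
      using assms(5) by (intro iffD1[OF resolvent_op_scale_iff assms(9)]) simp
    also have "(y n + \<sigma> *\<^sub>R K (xbar n) - y (Suc n)) /\<^sub>R \<sigma> = K (xbar n) - (y (Suc n) - y n) /\<^sub>R \<sigma>"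
      using assms(5) by (simp add: algebra_simps)
    finally show "K (x n + (x n - x (n - 1))) - (y (Suc n) - y n) /\<^sub>R \<sigma> \<in> op_inverse B (y (Suc n))"
      by (simp add: xbar)
    have "(x n - \<tau> *\<^sub>R adjoint K (y (Suc n)) - x (Suc n)) /\<^sub>R \<tau> \<in> A (x (Suc n))"
      using assms(6) by (intro iffD1[OF resolvent_op_scale_iff assms(10)]) simp
    also have "(x n - \<tau> *\<^sub>R adjoint K (y (Suc n)) - x (Suc n)) /\<^sub>R \<tau>
        = - adjoint K (y (Suc n)) - (x (Suc n) - x n) /\<^sub>R \<tau>"
      using assms(6) by (simp add: algebra_simps)
    finally show "- adjoint K (y (Suc n)) - (x (Suc n) - x n) /\<^sub>R \<tau> \<in> A (x (Suc n))" .
  qed (fact assms)+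
  have "bounded (range (\<lambda>n. (x n, y n)))"
    by (rule bounded_subset[OF bounded_Times[OF bounded_iterates[OF assms(4)]]]) auto
  moreover have "\<exists>xs ys. inclusion_solution A B K xs ys \<and> (\<lambda>n. (x n, y n)) \<longlonglongrightarrow> (xs, ys)"
    if "finite_dimensional_space TYPE('a)" "finite_dimensional_space TYPE('b)"
    by (rule convergence[OF assms(4) that]) (intro exI conjI tendsto_Pair)
  ultimately show ?thesis
    using distance_bound[OF assms(4)] by blast
qed

end
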